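(* Let $A,B$ and $S$ be non-empty subsets of a finite Abelian group $G$. Assume that $|A|+|B|=|G|+L_S$, where $L_S=|S|\,L(G)$, and that $|A\wedge^S B|=|G|-2|S|$. Then (i) there exists a subgroup $H$ of $2\cdot G$ such that $S$ is a coset modulo $H$, and (ii) $G\setminus(A\wedge^S B)$ is a union of two cosets modulo $H$.
   Context: Groups are written additively. For subsets $A,B,S$ of a finite Abelian group $G$: $A\wedge^S B=\{a+b:\ a\in A,\ b\in B,\ a-b\notin S\}$. For $z\in G$, $L_S(z)=|\{(x,y)\in G\times G:\ x+y=z,\ x-y\in S\}|$, and $L_S=\max_{z\in G}L_S(z)$. $L(G)=|\{x\in G:2x=0\}|$ and $2\cdot G=\{2x:x\in G\}$. *)

theory Defs
  imports "HOL-Algebra.Coset"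
begin

text \<open>HOL-Algebra groups are written multiplicatively: below, \<open>x \<otimes> y\<close> stands for \<open>x + y\<close>,
  \<open>x \<otimes> inv y\<close> for \<open>x - y\<close>, \<open>\<one>\<close> for \<open>0\<close> and \<open>x \<otimes> x\<close> for \<open>2x\<close>.\<close>

definition restricted_sumset :: "('a, 'b) monoid_scheme \<Rightarrow> 'a set \<Rightarrow> 'a set \<Rightarrow> 'a set \<Rightarrow> 'a set" where
  "restricted_sumset G S A B =
     {a \<otimes>\<^bsub>G\<^esub> b | a b. a \<in> A \<and> b \<in> B \<and> a \<otimes>\<^bsub>G\<^esub> inv\<^bsub>G\<^esub> b \<notin> S}"

definition L_at :: "('a, 'b) monoid_scheme \<Rightarrow> 'a set \<Rightarrow> 'a \<Rightarrow> nat" where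
  "L_at G S z = card {(x, y) \<in> carrier G \<times> carrier G.
     x \<otimes>\<^bsub>G\<^esub> y = z \<and> x \<otimes>\<^bsub>G\<^esub> inv\<^bsub>G\<^esub> y \<in> S}"

definition L_max :: "('a, 'b) monoid_scheme \<Rightarrow> 'a set \<Rightarrow> nat" where
  "L_max G S = Max (L_at G S ` carrier G)"

definition L_group :: "('a, 'b) monoid_scheme \<Rightarrow> nat" where
  "L_group G = card {x \<in> carrier G. x \<otimes>\<^bsub>G\<^esub> x = \<one>\<^bsub>G\<^esub>}"

definition doubles :: "('a, 'b) monoid_scheme \<Rightarrow> 'a set" where
  "doubles G = {x \<otimes>\<^bsub>G\<^esub> x | x. x \<in> carrier G}"

end

theory Submission
  imports Defs
begin

text \<open>Write the group additively and let \<open>Z\<close> be the set of elements missed by the restricted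
  sumset, so \<open>|Z| = 2|S|\<close>. For \<open>z \<in> Z\<close> every \<open>x\<close> in \<open>A \<inter> (z - B)\<close> satisfies \<open>2x \<in> z + S\<close>, and
  \<open>|A| + |B|\<close> is so large that all such \<open>x\<close> occur, that \<open>A \<union> (z - B) = G\<close>, and that
  \<open>z + S \<subseteq> 2 \<cdot> G\<close>. Let \<open>F\<close> be the set of elements all of whose halves lie in \<open>A\<close>, and \<open>E\<close> the set
  of those \<open>v\<close> for which no half of \<open>-v\<close> lies in \<open>B\<close>. Then \<open>F\<close> is the disjoint union of \<open>z + S\<close>
  and \<open>2z + E\<close>, for every \<open>z \<in> Z\<close>.

  Comparing these decompositions for three elements of \<open>Z\<close> shows, for \<open>t \<in> S\<close>, that two of
  them, \<open>z\<close> and \<open>w\<close>, satisfy \<open>t + z - w \<in> S\<close> and \<open>t + w - z \<in> S\<close>. This relation on the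
  \<open>2|S|\<close> points of \<open>Z\<close> has neighbourhoods of size at most \<open>|S|\<close> and no three pairwise
  unrelated points, so it is an equivalence with two classes of size \<open>|S|\<close>. The class of \<open>z\<close> is then \<open>(S - t) + z\<close>, which forces
  \<open>S - t\<close> to be a subgroup.\<close>

locale no_independent_triple =
  fixes Z :: "'a set" and r :: "('a \<times> 'a) set" and n :: nat
  assumes card_Z: "card Z = 2 * n" and n_pos: "0 < n"
    and r_subset: "r \<subseteq> Z \<times> Z" and refl_r: "refl_on Z r" and sym_r: "sym r"
    and degree_le: "z \<in> Z \<Longrightarrow> card (r `` {z}) \<le> n"
    and related_pair: "\<lbrakk>x \<in> Z; y \<in> Z; z \<in> Z\<rbrakk> \<Longrightarrow> (x, y) \<in> r \<or> (x, z) \<in> r \<or> (y, z) \<in> r"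
begin

lemma finite_class: "finite (r `` {z})"
proof -
  have "finite Z" using card_Z n_pos by (simp add: card_ge_0_finite)
  then show ?thesis using r_subset by (auto intro: finite_subset)
qed

lemma
  assumes "z \<in> Z" "w \<in> Z" "(z, w) \<notin> r"
  shows unrelated_classes_cover: "Z = r `` {z} \<union> r `` {w}"
    and unrelated_classes_disjoint: "r `` {z} \<inter> r `` {w} = {}"
    and card_class_if_unrelated: "card (r `` {z}) = n"
proof -
  show cover: "Z = r `` {z} \<union> r `` {w}"
    using related_pair[OF assms(1,2)] assms(3) r_subset by auto
  have "card (r `` {z}) + card (r `` {w}) = 2 * n + card (r `` {z} \<inter> r `` {w})"
    using card_Un_Int[OF finite_class finite_class, of z w] cover card_Z by simp
  with degree_le[OF assms(1)] degree_le[OF assms(2)]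
  have "card (r `` {z}) = n \<and> card (r `` {z} \<inter> r `` {w}) = 0" by linarith
  then show "r `` {z} \<inter> r `` {w} = {}" "card (r `` {z}) = n" using finite_class by simp_all
qed

lemma obtain_unrelated:
  assumes "z \<in> Z"
  obtains w where "w \<in> Z" "(z, w) \<notin> r"
proof -
  have "r `` {z} \<noteq> Z" using degree_le[OF assms] card_Z n_pos by auto
  then show thesis using that r_subset by auto
qed

lemma card_class: "z \<in> Z \<Longrightarrow> card (r `` {z}) = n"
  using obtain_unrelated card_class_if_unrelated by metis

lemma equiv_r: "equiv Z r"
proof -
  have "trans r"
  proof (rule transI, rule ccontr)
    fix x y z assume xyz: "(x, y) \<in> r" "(y, z) \<in> r" "(x, z) \<notin> r"
    then have "y \<in> r `` {x} \<inter> r `` {z}" using sym_r by (auto dest: symD)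
    then show False using unrelated_classes_disjoint[of x z] xyz r_subset by blast
  qed
  then show ?thesis using r_subset refl_r sym_r by (simp add: equiv_def)
qed

lemma two_classes:
  obtains z w where "z \<in> Z" "w \<in> Z" "r `` {z} \<noteq> r `` {w}" "Z = r `` {z} \<union> r `` {w}"
proof -
  obtain z where z: "z \<in> Z" using card_Z n_pos by fastforce
  then obtain w where w: "w \<in> Z" "(z, w) \<notin> r" by (rule obtain_unrelated)
  then have "r `` {z} \<noteq> r `` {w}" using equiv_class_self[OF equiv_r] by blast
  then show thesis using that unrelated_classes_cover z w by blast
qed

end

context group
begin

lemma inv_mult_cancel_left [simp]:
  assumes "x \<in> carrier G" "y \<in> carrier G"
  shows "inv x \<otimes> (x \<otimes> y) = y" and "x \<otimes> (inv x \<otimes> y) = y"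
  using assms by (simp_all add: m_assoc[symmetric])

lemma inv_mult_cancel_right [simp]:
  assumes "x \<in> carrier G" "y \<in> carrier G"
  shows "x \<otimes> y \<otimes> inv y = x" and "x \<otimes> inv y \<otimes> y = x"
  using assms by (simp_all add: m_assoc)

lemma card_r_coset: "\<lbrakk>H \<subseteq> carrier G; x \<in> carrier G\<rbrakk> \<Longrightarrow> card (H #> x) = card H"
  using card_rcosets_equal rcosetsI by metis

lemma subgroup_if_r_cosets_equiv_classes:
  assumes "equiv Z r" and "Z \<subseteq> carrier G" and "Z \<noteq> {}" and "H \<subseteq> carrier G"
    and classes: "\<And>z. z \<in> Z \<Longrightarrow> r `` {z} = H #> z"
  shows "subgroup H G"
proof
  obtain z where z: "z \<in> Z" using \<open>Z \<noteq> {}\<close> by blast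
  then have [simp]: "z \<in> carrier G" using \<open>Z \<subseteq> carrier G\<close> by blast
  have [simp]: "h \<in> carrier G" if "h \<in> H" for h using that \<open>H \<subseteq> carrier G\<close> by blast
  have mem_H: "g \<in> H" if "g \<otimes> z \<in> H #> z" "g \<in> carrier G" for g
    using that by (auto simp: r_coset_def)
  have z_self: "z \<in> H #> z"
    using equiv_class_self[OF \<open>equiv Z r\<close> z] classes[OF z] by simp
  then show "\<one> \<in> H" using mem_H by simp
  show "H \<subseteq> carrier G" by fact
  fix h assume "h \<in> H"
  then have hz: "(z, h \<otimes> z) \<in> r" using classes[OF z] by (auto simp: r_coset_def)
  then have coset_eq: "H #> (h \<otimes> z) = H #> z"
    using equiv_class_eq[OF \<open>equiv Z r\<close> hz] equiv_type[OF \<open>equiv Z r\<close>] classes by auto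
  show "g \<otimes> h \<in> H" if "g \<in> H" for g
    using that \<open>h \<in> H\<close> coset_eq rcosI[of g H "h \<otimes> z"] \<open>H \<subseteq> carrier G\<close>
    by (intro mem_H) (simp_all add: m_assoc)
  obtain g where "g \<in> H" "z = g \<otimes> (h \<otimes> z)"
    using z_self unfolding coset_eq[symmetric] by (auto simp: r_coset_def)
  then have "g \<otimes> h \<otimes> z = z" using \<open>h \<in> H\<close> by (simp add: m_assoc)
  then have "g \<otimes> h = \<one>" using \<open>g \<in> H\<close> \<open>h \<in> H\<close> by simp
  then show "inv h \<in> H" using \<open>g \<in> H\<close> \<open>h \<in> H\<close> by (simp add: inv_equality)
qed

lemma subgroup_subset_if_r_coset_subset:
  assumes "subgroup H G" and "subgroup K G" and "x \<in> carrier G" and "H #> x \<subseteq> K"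
  shows "H \<subseteq> K"
proof
  interpret K: subgroup K G by fact
  fix h assume "h \<in> H"
  then have [simp]: "h \<in> carrier G" using subgroup.mem_carrier[OF \<open>subgroup H G\<close>] by blast
  have "x \<in> K" using rcos_self assms by blast
  moreover have "h \<otimes> x \<in> K" using \<open>h \<in> H\<close> \<open>H #> x \<subseteq> K\<close> by (auto simp: r_coset_def)
  ultimately have "h \<otimes> x \<otimes> inv x \<in> K" by (blast intro: K.m_closed K.m_inv_closed)
  then show "h \<in> K" using \<open>x \<in> carrier G\<close> by simp
qed

end

text \<open>In the group ring the axioms say \<open>F = S z + E z\<^sup>2\<close> for all \<open>z \<in> Z\<close>: the elements of \<open>Z\<close> are
  roots of one quadratic polynomial.\<close>

locale quadratic_tiling = comm_group G for G (structure) +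
  fixes E F S Z :: "'a set"
  assumes S_subset: "S \<subseteq> carrier G" and Z_subset: "Z \<subseteq> carrier G"
    and mem_F_iff: "\<lbrakk>z \<in> Z; v \<in> carrier G\<rbrakk> \<Longrightarrow> v \<otimes> z \<otimes> z \<in> F \<longleftrightarrow> v \<otimes> z \<in> S \<or> v \<in> E"
    and not_in_E: "\<lbrakk>z \<in> Z; v \<in> carrier G; v \<otimes> z \<in> S\<rbrakk> \<Longrightarrow> v \<notin> E"
begin

lemma S_carrier [simp]: "t \<in> S \<Longrightarrow> t \<in> carrier G" using S_subset by blast
lemma Z_carrier [simp]: "z \<in> Z \<Longrightarrow> z \<in> carrier G" using Z_subset by blast

lemma quadratic_tiling_dual: "quadratic_tiling G (- F) (- E) S (m_inv G ` Z)"
proof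
  show "m_inv G ` Z \<subseteq> carrier G" by auto
  fix z v assume "z \<in> m_inv G ` Z" and [simp]: "v \<in> carrier G"
  then obtain w where w: "w \<in> Z" "z = inv w" by blast
  define u where "u = v \<otimes> z \<otimes> z"
  have [simp]: "u \<in> carrier G" "u \<otimes> w = v \<otimes> z" "v \<otimes> z \<otimes> w = v"
    using w by (simp_all add: u_def m_assoc)
  show "v \<otimes> z \<otimes> z \<in> - E \<longleftrightarrow> v \<otimes> z \<in> S \<or> v \<in> - F"
    using mem_F_iff[OF w(1), of u] not_in_E[OF w(1), of u] by (auto simp: u_def[symmetric])
  show "v \<notin> - F" if "v \<otimes> z \<in> S"
    using that mem_F_iff[OF w(1), of u] by simp
qed (rule S_subset)

lemma E_shift:
  assumes "z \<in> Z" "w \<in> Z" "v \<in> carrier G" "v \<otimes> w \<in> E" "v \<otimes> z \<otimes> w \<otimes> w \<in> F"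
  shows "v \<otimes> z \<in> E"
proof (rule ccontr)
  assume "v \<otimes> z \<notin> E"
  then have "v \<otimes> w \<otimes> z \<in> S" using assms mem_F_iff[of w "v \<otimes> z"] by (simp add: m_ac)
  then show False using assms not_in_E[of z "v \<otimes> w"] by simp
qed

definition E_hit :: "'a \<Rightarrow> 'a \<Rightarrow> 'a \<Rightarrow> 'a \<Rightarrow> bool" where
  "E_hit t x y z \<longleftrightarrow> t \<otimes> x \<otimes> inv y \<otimes> inv z \<in> E"

text \<open>This is \<open>E_hit\<close> for the dual tiling, at the inverses of \<open>x\<close>, \<open>y\<close> and \<open>z\<close>.\<close>

definition F_miss :: "'a \<Rightarrow> 'a \<Rightarrow> 'a \<Rightarrow> 'a \<Rightarrow> bool" where
  "F_miss t x y z \<longleftrightarrow> t \<otimes> inv x \<otimes> y \<otimes> z \<notin> F"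

lemma E_hit_commute:
  "\<lbrakk>t \<in> S; x \<in> Z; y \<in> Z; z \<in> Z\<rbrakk> \<Longrightarrow> E_hit t x z y \<longleftrightarrow> E_hit t x y z"
  by (simp add: E_hit_def m_ac)

lemma F_miss_commute:
  "\<lbrakk>t \<in> S; x \<in> Z; y \<in> Z; z \<in> Z\<rbrakk> \<Longrightarrow> F_miss t x z y \<longleftrightarrow> F_miss t x y z"
  by (simp add: F_miss_def m_ac)

lemma F_miss_iff:
  assumes "t \<in> S" "x \<in> Z" "y \<in> Z" "z \<in> Z"
  shows "F_miss t x y z \<longleftrightarrow> t \<otimes> y \<otimes> inv x \<notin> S \<and> \<not> E_hit t y x z"
proof -
  have "t \<otimes> y \<otimes> inv x \<otimes> inv z \<otimes> z \<otimes> z = t \<otimes> inv x \<otimes> y \<otimes> z"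
    and "t \<otimes> y \<otimes> inv x \<otimes> inv z \<otimes> z = t \<otimes> y \<otimes> inv x"
    using assms by (simp_all add: m_assoc) (simp add: m_lcomm)
  then show ?thesis
    using mem_F_iff[of z "t \<otimes> y \<otimes> inv x \<otimes> inv z"] assms by (simp add: F_miss_def E_hit_def)
qed

text \<open>All points of the proof are \<open>c\<close> times a monomial in \<open>x\<close>, \<open>y\<close>, \<open>z\<close>, so that they can be compared
  without cancelling.\<close>

lemma not_two_E_hits:
  assumes t: "t \<in> S" and Z: "x \<in> Z" "y \<in> Z" "z \<in> Z"
  shows "\<not> (E_hit t x y z \<and> E_hit t y x z)"
proof
  assume hits: "E_hit t x y z \<and> E_hit t y x z"
  note [simp] = Z[THEN Z_carrier] S_carrier[OF t]
  define c where "c = t \<otimes> inv (x \<otimes> y \<otimes> y \<otimes> z \<otimes> z)"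
  have [simp]: "c \<in> carrier G" by (simp add: c_def)
  have "c \<otimes> (x \<otimes> y \<otimes> y \<otimes> z \<otimes> z) = t" by (simp add: c_def m_assoc l_inv)
  then have t_eq: "t = c \<otimes> x \<otimes> y \<otimes> y \<otimes> z \<otimes> z" by (simp add: m_assoc)
  have "t \<otimes> x = c \<otimes> x \<otimes> x \<otimes> y \<otimes> z \<otimes> z \<otimes> y" "t \<otimes> y = c \<otimes> y \<otimes> y \<otimes> y \<otimes> z \<otimes> z \<otimes> x"
    by (simp_all add: t_eq m_ac)
  with hits have E_x: "c \<otimes> x \<otimes> x \<otimes> y \<otimes> z \<in> E" and E_y: "c \<otimes> y \<otimes> y \<otimes> y \<otimes> z \<in> E"
    by (simp_all add: E_hit_def)
  have F_x: "c \<otimes> x \<otimes> x \<otimes> y \<otimes> y \<otimes> z \<otimes> z \<in> F"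
    using mem_F_iff[OF Z(1), of "c \<otimes> y \<otimes> y \<otimes> z \<otimes> z"] t by (simp add: t_eq m_ac)
  have F_y: "c \<otimes> x \<otimes> y \<otimes> y \<otimes> y \<otimes> z \<otimes> z \<in> F"
    using mem_F_iff[OF Z(2), of "c \<otimes> x \<otimes> y \<otimes> z \<otimes> z"] t by (simp add: t_eq m_ac)
  have E_xxyy: "c \<otimes> x \<otimes> x \<otimes> y \<otimes> y \<in> E"
    using E_shift[OF Z(2,3), of "c \<otimes> x \<otimes> x \<otimes> y"] E_x F_x by (simp add: m_ac)
  have E_xxzz: "c \<otimes> x \<otimes> x \<otimes> z \<otimes> z \<in> E"
    using E_shift[OF Z(3,2), of "c \<otimes> x \<otimes> x \<otimes> z"] E_x F_x by (simp add: m_ac)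
  have "c \<otimes> x \<otimes> y \<otimes> y \<otimes> y \<in> E"
    using E_shift[OF Z(1,3), of "c \<otimes> y \<otimes> y \<otimes> y"] E_y F_y by (simp add: m_ac)
  then have "c \<otimes> x \<otimes> x \<otimes> x \<otimes> y \<otimes> y \<otimes> y \<in> F"
    using mem_F_iff[OF Z(1), of "c \<otimes> x \<otimes> y \<otimes> y \<otimes> y"] by (simp add: m_ac)
  then have "c \<otimes> x \<otimes> x \<otimes> x \<otimes> y \<in> E"
    using E_shift[OF Z(1,2), of "c \<otimes> x \<otimes> x \<otimes> y"] E_xxyy by (simp add: m_ac)
  then have "c \<otimes> x \<otimes> x \<otimes> x \<otimes> y \<otimes> z \<otimes> z \<in> F"
    using mem_F_iff[OF Z(3), of "c \<otimes> x \<otimes> x \<otimes> x \<otimes> y"] by (simp add: m_ac)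
  then have "c \<otimes> x \<otimes> y \<otimes> z \<otimes> z \<in> E"
    using E_shift[OF Z(2,1), of "c \<otimes> x \<otimes> z \<otimes> z"] E_xxzz by (simp add: m_ac)
  then show False
    using not_in_E[OF Z(2), of "c \<otimes> x \<otimes> y \<otimes> z \<otimes> z"] t by (simp add: t_eq m_ac)
qed

lemma not_two_F_misses:
  assumes "t \<in> S" "x \<in> Z" "y \<in> Z" "z \<in> Z"
  shows "\<not> (F_miss t x y z \<and> F_miss t y x z)"
proof -
  interpret dual: quadratic_tiling G "- F" "- E" S "m_inv G ` Z"
    by (rule quadratic_tiling_dual)
  show ?thesis
    using dual.not_two_E_hits[of t "inv x" "inv y" "inv z"] assms
    by (simp add: dual.E_hit_def F_miss_def)
qed

definition links :: "'a \<Rightarrow> ('a \<times> 'a) set" where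
  "links t = {(x, y) \<in> Z \<times> Z. t \<otimes> x \<otimes> inv y \<in> S \<and> t \<otimes> y \<otimes> inv x \<in> S}"

lemma E_hit_or_F_miss_if_not_linked:
  assumes "t \<in> S" "x \<in> Z" "y \<in> Z" "z \<in> Z" "(x, y) \<notin> links t"
  shows "E_hit t x y z \<or> E_hit t y x z \<or> F_miss t x y z \<or> F_miss t y x z"
  using assms F_miss_iff[of t x y z] F_miss_iff[of t y x z] by (auto simp: links_def)

lemma linked_pair_of_three:
  assumes t: "t \<in> S" and Z: "x \<in> Z" "y \<in> Z" "z \<in> Z"
  shows "(x, y) \<in> links t \<or> (x, z) \<in> links t \<or> (y, z) \<in> links t"
proof (rule ccontr)
  assume not_linked: "\<not> ?thesis"
  define marked where
    "marked u v w \<longleftrightarrow> E_hit t u v w \<or> F_miss t u v w" for u v w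
  have marked_commute: "marked u w v \<longleftrightarrow> marked u v w" if "u \<in> Z" "v \<in> Z" "w \<in> Z" for u v w
    using that t by (simp add: marked_def E_hit_commute F_miss_commute)
  have not_both_marked: "\<not> (marked u v w \<and> marked v u w)"
    if "u \<in> Z" "v \<in> Z" "w \<in> Z" for u v w
    using not_two_E_hits[OF t that] not_two_F_misses[OF t that] F_miss_iff[OF t, of v u w]
      F_miss_iff[OF t, of u v w] that by (auto simp: marked_def)
  have one_marked: "marked u v w \<or> marked v u w"
    if "(u, v) \<notin> links t" "u \<in> Z" "v \<in> Z" "w \<in> Z" for u v w
    using E_hit_or_F_miss_if_not_linked[OF t that(2-4,1)] by (auto simp: marked_def)
  \<comment> \<open>The three unlinked pairs mark at least two of \<open>x\<close>, \<open>y\<close>, \<open>z\<close>.\<close>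
  show False using not_both_marked one_marked not_linked Z marked_commute by metis
qed

lemma links_class_subset:
  assumes t: "t \<in> S" and z: "z \<in> Z"
  shows "links t `` {z} \<subseteq> S #> inv t #> z"
proof
  fix w assume "w \<in> links t `` {z}"
  then have w: "w \<in> Z" "t \<otimes> w \<otimes> inv z \<in> S" by (auto simp: links_def)
  then have "t \<otimes> w \<otimes> inv z \<otimes> inv t \<otimes> z \<in> S #> inv t #> z" by (auto simp: r_coset_def)
  moreover have "t \<otimes> w \<otimes> inv z \<otimes> inv t \<otimes> z = w"
    using t w z by (simp add: m_comm[of t w] m_comm[of t "inv z"] m_assoc)
  ultimately show "w \<in> S #> inv t #> z" by simp
qed

theorem S_rcoset_and_Z_union_of_two_rcosets:
  assumes "finite S" "S \<noteq> {}" "card Z = 2 * card S"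
  obtains H where "subgroup H G" "S \<in> rcosets H"
    "\<exists>C\<in>rcosets H. \<exists>D\<in>rcosets H. C \<noteq> D \<and> Z = C \<union> D"
proof -
  obtain t where t [simp]: "t \<in> S" using \<open>S \<noteq> {}\<close> by blast
  define H where "H = S #> inv t"
  have H_subset: "H \<subseteq> carrier G" using S_subset by (simp add: H_def r_coset_subset_G)
  have S_coset: "S \<in> rcosets H"
    using rcosetsI[OF H_subset, of t] S_subset by (simp add: H_def coset_mult_assoc)
  have card_coset: "card (H #> z) = card S" if "z \<in> Z" for z
    using that S_subset H_subset by (simp add: card_r_coset) (simp add: H_def card_r_coset)
  have finite_coset: "finite (H #> z)" for z
    using \<open>finite S\<close> by (simp add: H_def r_coset_def)
  have class_subset: "links t `` {z} \<subseteq> H #> z" if "z \<in> Z" for z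
    using links_class_subset[OF t that] by (simp add: H_def)
  interpret no_independent_triple Z "links t" "card S"
  proof
    show "card Z = 2 * card S" "0 < card S" using assms by (simp_all add: card_gt_0_iff)
    show "links t \<subseteq> Z \<times> Z" "refl_on Z (links t)" "sym (links t)"
      by (auto simp: links_def refl_on_def sym_def)
    show "card (links t `` {z}) \<le> card S" if "z \<in> Z" for z
      using card_mono[OF finite_coset class_subset] card_coset that by simp
  qed (rule linked_pair_of_three[OF t])
  have class_eq: "links t `` {z} = H #> z" if "z \<in> Z" for z
    using card_subset_eq[OF finite_coset class_subset] card_class card_coset that by simp
  obtain z w where zw: "z \<in> Z" "w \<in> Z" "H #> z \<noteq> H #> w" "Z = (H #> z) \<union> (H #> w)"
    using two_classes class_eq by metis
  have "subgroup H G"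
    using subgroup_if_r_cosets_equiv_classes[OF equiv_r Z_subset _ H_subset class_eq] zw(1)
    by blast
  moreover have "\<exists>C\<in>rcosets H. \<exists>D\<in>rcosets H. C \<noteq> D \<and> Z = C \<union> D"
    using zw rcosetsI[OF H_subset] Z_carrier by blast
  ultimately show thesis using that S_coset by blast
qed

end

context comm_group
begin

lemma doubles_subgroup: "subgroup (doubles G) G"
proof -
  have "group_hom G G (\<lambda>x. x \<otimes> x)" by unfold_locales (simp add: hom_def Pi_iff m_ac)
  moreover have "doubles G = (\<lambda>x. x \<otimes> x) ` carrier G" by (auto simp: doubles_def)
  ultimately show ?thesis using group_hom.img_is_subgroup by metis
qed

definition square_roots :: "'a \<Rightarrow> 'a set" where
  "square_roots u = {x \<in> carrier G. x \<otimes> x = u}"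

lemma square_roots_nonempty_iff: "square_roots u \<noteq> {} \<longleftrightarrow> u \<in> doubles G"
  by (auto simp: square_roots_def doubles_def)

lemma card_square_roots_le:
  assumes "finite (carrier G)"
  shows "card (square_roots u) \<le> L_group G"
proof (cases "square_roots u = {}")
  case False
  then obtain a where a: "a \<in> carrier G" "a \<otimes> a = u" by (auto simp: square_roots_def)
  have "(x \<otimes> inv a) \<otimes> (x \<otimes> inv a) = (x \<otimes> x) \<otimes> inv (a \<otimes> a)" if "x \<in> carrier G" for x
    using that a(1) by (simp add: m_ac inv_mult)
  then have "(\<lambda>x. x \<otimes> inv a) ` square_roots u \<subseteq> {x \<in> carrier G. x \<otimes> x = \<one>}"
    using a by (auto simp: square_roots_def)
  moreover have "inj_on (\<lambda>x. x \<otimes> inv a) (square_roots u)"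
    using a by (intro inj_on_g) (auto simp: square_roots_def)
  ultimately show ?thesis
    unfolding L_group_def using assms by (intro card_inj_on_le) auto
qed simp

lemma L_group_pos: "finite (carrier G) \<Longrightarrow> 0 < L_group G"
  unfolding L_group_def by (subst card_gt_0_iff) auto

lemma mult_inv_mem_square_roots_iff:
  assumes "x \<in> carrier G" "v \<in> carrier G" "z \<in> carrier G"
  shows "z \<otimes> inv x \<in> square_roots (inv v) \<longleftrightarrow> x \<in> square_roots (v \<otimes> z \<otimes> z)"
proof -
  have "(z \<otimes> inv x) \<otimes> (z \<otimes> inv x) = (z \<otimes> z) \<otimes> inv (x \<otimes> x)"
    using assms by (simp add: m_ac inv_mult)
  then have "(z \<otimes> inv x) \<otimes> (z \<otimes> inv x) = inv v \<longleftrightarrow> z \<otimes> z = inv v \<otimes> (x \<otimes> x)"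
    using assms by (simp add: inv_solve_right')
  also have "\<dots> \<longleftrightarrow> x \<otimes> x = v \<otimes> z \<otimes> z"
    using assms by (simp add: inv_solve_left m_assoc)
  finally show ?thesis using assms by (simp add: square_roots_def)
qed

end

locale extremal_restricted_sumset = comm_group G for G (structure) +
  fixes A B S :: "'a set"
  assumes finite_carrier: "finite (carrier G)"
    and A_subset: "A \<subseteq> carrier G" and B_subset: "B \<subseteq> carrier G" and S_subset: "S \<subseteq> carrier G"
    and card_A_B: "card A + card B = order G + card S * L_group G"
begin

definition missed :: "'a set" where
  "missed = carrier G - restricted_sumset G S A B"

definition reflected_B :: "'a \<Rightarrow> 'a set" where
  "reflected_B z = {x \<in> carrier G. z \<otimes> inv x \<in> B}"

lemma missed_carrier [simp]: "z \<in> missed \<Longrightarrow> z \<in> carrier G"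
  by (simp add: missed_def)

lemma S_carrier [simp]: "t \<in> S \<Longrightarrow> t \<in> carrier G"
  using S_subset by blast

lemma card_reflected_B:
  assumes "z \<in> carrier G"
  shows "card (reflected_B z) = card B"
proof (rule bij_betw_same_card)
  show "bij_betw (\<lambda>x. z \<otimes> inv x) (reflected_B z) B"
    using assms B_subset
    by (intro bij_betw_byWitness[where f' = "\<lambda>y. z \<otimes> inv y"])
      (auto simp: reflected_B_def inv_mult subset_iff)
qed

lemma Int_reflected_B_subset:
  assumes "z \<in> missed"
  shows "A \<inter> reflected_B z \<subseteq> (\<Union>t\<in>S. square_roots (t \<otimes> z))"
proof
  fix x assume "x \<in> A \<inter> reflected_B z"
  then have x: "x \<in> A" "x \<in> carrier G" "z \<otimes> inv x \<in> B" by (auto simp: reflected_B_def)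
  define t where "t = x \<otimes> inv (z \<otimes> inv x)"
  have "x \<otimes> (z \<otimes> inv x) = z" using assms x by (simp add: m_lcomm[of x])
  moreover have "z \<notin> restricted_sumset G S A B" using assms by (simp add: missed_def)
  ultimately have "t \<in> S" using x unfolding restricted_sumset_def t_def by force
  moreover have "t \<otimes> z = x \<otimes> x" using assms x by (simp add: t_def inv_mult m_ac)
  ultimately have "t \<in> S" "x \<in> square_roots (t \<otimes> z)"
    using x by (simp_all add: square_roots_def)
  then show "x \<in> (\<Union>t\<in>S. square_roots (t \<otimes> z))" by blast
qed

lemma
  assumes z: "z \<in> missed"
  shows Int_reflected_B: "A \<inter> reflected_B z = (\<Union>t\<in>S. square_roots (t \<otimes> z))"
    and Un_reflected_B: "A \<union> reflected_B z = carrier G"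
    and mult_missed_mem_doubles: "\<And>t. t \<in> S \<Longrightarrow> t \<otimes> z \<in> doubles G"
proof -
  define U where "U = (\<Union>t\<in>S. square_roots (t \<otimes> z))"
  have subsets: "U \<subseteq> carrier G" "A \<union> reflected_B z \<subseteq> carrier G"
    using A_subset by (auto simp: U_def square_roots_def reflected_B_def)
  have finite: "finite S" "finite U" "finite A" "finite (reflected_B z)"
    using finite_subset[OF _ finite_carrier] S_subset subsets by auto
  have card_sum: "card A + card B = card (A \<union> reflected_B z) + card (A \<inter> reflected_B z)"
    using card_Un_Int[OF finite(3,4)] card_reflected_B z by simp
  have card_Un_le: "card (A \<union> reflected_B z) \<le> order G"
    unfolding order_def using subsets(2) by (rule card_mono[OF finite_carrier])
  have card_Int_le: "card (A \<inter> reflected_B z) \<le> card U"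
    using Int_reflected_B_subset[OF z] finite(2) by (simp add: U_def card_mono)
  have card_U_le: "card U \<le> (\<Sum>t\<in>S. card (square_roots (t \<otimes> z)))"
    unfolding U_def by (rule card_UN_le[OF finite(1)])
  have sum_le: "(\<Sum>t\<in>S. card (square_roots (t \<otimes> z))) \<le> (\<Sum>t\<in>S. L_group G)"
    by (intro sum_mono card_square_roots_le finite_carrier)
  have eqs: "card (A \<inter> reflected_B z) = card U" "card (A \<union> reflected_B z) = order G"
    "(\<Sum>t\<in>S. card (square_roots (t \<otimes> z))) = (\<Sum>t\<in>S. L_group G)"
    using card_A_B card_sum card_Un_le card_Int_le card_U_le sum_le by simp_all
  show "A \<inter> reflected_B z = (\<Union>t\<in>S. square_roots (t \<otimes> z))"
    using card_subset_eq[OF finite(2) _ eqs(1)] Int_reflected_B_subset[OF z] by (simp add: U_def)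
  show "A \<union> reflected_B z = carrier G"
    using card_subset_eq[OF finite_carrier subsets(2)] eqs(2) by (simp add: order_def)
  fix t assume "t \<in> S"
  then have "card (square_roots (t \<otimes> z)) = L_group G"
    using sum_mono_inv[OF eqs(3)] card_square_roots_le finite_carrier finite(1) by blast
  then have "square_roots (t \<otimes> z) \<noteq> {}" using L_group_pos[OF finite_carrier] by fastforce
  then show "t \<otimes> z \<in> doubles G" by (simp only: square_roots_nonempty_iff)
qed

definition roots_within_A :: "'a set" where
  "roots_within_A = {u. square_roots u \<subseteq> A}"

definition inv_roots_avoid_B :: "'a set" where
  "inv_roots_avoid_B = {v. square_roots (inv v) \<inter> B = {}}"

lemma mem_inv_roots_avoid_B_iff:
  assumes "v \<in> carrier G" "z \<in> carrier G"
  shows "v \<in> inv_roots_avoid_B \<longleftrightarrow> square_roots (v \<otimes> z \<otimes> z) \<inter> reflected_B z = {}"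
proof -
  have "z \<otimes> inv x \<in> square_roots (inv v) \<inter> B"
    if "x \<in> square_roots (v \<otimes> z \<otimes> z) \<inter> reflected_B z" for x
    using that assms by (simp add: reflected_B_def mult_inv_mem_square_roots_iff)
  moreover have "z \<otimes> inv y \<in> square_roots (v \<otimes> z \<otimes> z) \<inter> reflected_B z"
    if "y \<in> square_roots (inv v) \<inter> B" for y
  proof -
    have [simp]: "y \<in> carrier G" using that by (simp add: square_roots_def)
    have "z \<otimes> inv (z \<otimes> inv y) = y" using assms by (simp add: inv_mult)
    then show ?thesis
      using that assms mult_inv_mem_square_roots_iff[of "z \<otimes> inv y" v z]
      by (simp add: reflected_B_def)
  qed
  ultimately show ?thesis unfolding inv_roots_avoid_B_def by blast
qed

sublocale quadratic_tiling G inv_roots_avoid_B roots_within_A S missed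
proof
  show "S \<subseteq> carrier G" by (fact S_subset)
  show "missed \<subseteq> carrier G" by (auto simp: missed_def)
  fix z v assume z: "z \<in> missed" and v: "v \<in> carrier G"
  define R where "R = square_roots (v \<otimes> z \<otimes> z)"
  have mem_avoid: "v \<in> inv_roots_avoid_B \<longleftrightarrow> R \<inter> reflected_B z = {}"
    using mem_inv_roots_avoid_B_iff[OF v, of z] z by (simp add: R_def)
  have mem_within: "v \<otimes> z \<otimes> z \<in> roots_within_A \<longleftrightarrow> R \<subseteq> A"
    by (simp add: roots_within_A_def R_def)
  have covered: "R \<subseteq> A \<union> reflected_B z"
    using Un_reflected_B[OF z] by (auto simp: R_def square_roots_def)
  have R_Int: "x \<in> A \<inter> reflected_B z \<longleftrightarrow> v \<otimes> z \<in> S" if "x \<in> R" for x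
    using that v z unfolding Int_reflected_B[OF z] by (auto simp: R_def square_roots_def)
  have R_nonempty: "R \<noteq> {}" if "v \<otimes> z \<in> S"
    using mult_missed_mem_doubles[OF z that] square_roots_nonempty_iff by (simp add: R_def)
  show "v \<notin> inv_roots_avoid_B" if "v \<otimes> z \<in> S"
    using R_nonempty R_Int that mem_avoid by blast
  show "v \<otimes> z \<otimes> z \<in> roots_within_A \<longleftrightarrow> v \<otimes> z \<in> S \<or> v \<in> inv_roots_avoid_B"
    using covered R_Int mem_avoid mem_within by blast
qed

lemma card_missed: "card missed = order G - card (restricted_sumset G S A B)"
proof -
  have "restricted_sumset G S A B \<subseteq> carrier G"
    using A_subset B_subset by (auto simp: restricted_sumset_def)
  then show ?thesis
    unfolding missed_def order_def using finite_carrier by (meson card_Diff_subset finite_subset)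
qed

lemma subset_doubles_if_S_rcoset:
  assumes "subgroup H G" and "S \<in> rcosets H" and "z \<in> missed"
  shows "H \<subseteq> doubles G"
proof -
  obtain x where x: "x \<in> carrier G" "S = H #> x" using assms(2) by (auto simp: RCOSETS_def)
  have "S #> z \<subseteq> doubles G"
    using mult_missed_mem_doubles[OF assms(3)] by (auto simp: r_coset_def)
  moreover have "S #> z = H #> (x \<otimes> z)"
    using x assms by (simp add: coset_mult_assoc subgroup.subset)
  ultimately have "H #> (x \<otimes> z) \<subseteq> doubles G" by simp
  then show ?thesis
    by (rule subgroup_subset_if_r_coset_subset[OF assms(1) doubles_subgroup, rotated])
      (simp add: x(1) assms(3))
qed

end

theorem theorem16:
  fixes G :: "('a, 'b) monoid_scheme" and A B S :: "'a set"
  assumes "comm_group G" and "finite (carrier G)"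
    and "A \<subseteq> carrier G" and "B \<subseteq> carrier G" and "S \<subseteq> carrier G"
    and "A \<noteq> {}" and "B \<noteq> {}" and "S \<noteq> {}"
    and "card A + card B = order G + L_max G S"
    and "L_max G S = card S * L_group G"
    and "int (card (restricted_sumset G S A B)) = int (order G) - 2 * int (card S)"
  shows "\<exists>H. subgroup H (G\<lparr>carrier := doubles G\<rparr>) \<and>
           S \<in> rcosets\<^bsub>G\<^esub> H \<and>
           (\<exists>C \<in> rcosets\<^bsub>G\<^esub> H. \<exists>D \<in> rcosets\<^bsub>G\<^esub> H. C \<noteq> D \<and>
              carrier G - restricted_sumset G S A B = C \<union> D)"
proof -
  interpret comm_group G by fact
  interpret extremal_restricted_sumset G A B S
    using assms by unfold_locales auto
  have card_missed_eq: "card missed = 2 * card S"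
    using card_missed assms(11) by linarith
  have "finite S" using assms finite_subset by blast
  then obtain H where H: "subgroup H G" "S \<in> rcosets\<^bsub>G\<^esub> H"
      "\<exists>C\<in>rcosets\<^bsub>G\<^esub> H. \<exists>D\<in>rcosets\<^bsub>G\<^esub> H. C \<noteq> D \<and> missed = C \<union> D"
    using S_rcoset_and_Z_union_of_two_rcosets \<open>S \<noteq> {}\<close> card_missed_eq by blast
  have "missed \<noteq> {}" using card_missed_eq \<open>finite S\<close> \<open>S \<noteq> {}\<close> by auto
  then have "H \<subseteq> doubles G" using subset_doubles_if_S_rcoset[OF H(1,2)] by blast
  then have "subgroup H (G\<lparr>carrier := doubles G\<rparr>)"
    by (intro subgroup_incl H doubles_subgroup)
  with H(2,3) show ?thesis unfolding missed_def by blast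
qed

end
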